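(* Let $f:\mathbb R^n\to[0,\infty)$ be an $L_p$-nested function with fixed values of its exponents $p_\emptyset,p_1,\dots$, and let $\rho(f(\boldsymbol x))$ be any $L_p$-nested symmetric probability density on $\mathbb R^n$ with respect to $f$. Consider the location-scale model $p(\boldsymbol x\mid\boldsymbol\mu,\tau)=\tau^n\rho(f(\tau(\boldsymbol x-\boldsymbol\mu)))$ with location $\boldsymbol\mu\in\mathbb R^n$ and scale $\tau>0$, and two independent priors $p(\boldsymbol\mu,\tau)=p(\boldsymbol\mu)\cdot c\,\tau^{-1}$, where the prior on $\tau$ is an improper Jeffreys prior. Then the joint distribution $p(\boldsymbol x,\boldsymbol\mu)=\int_0^\infty p(\boldsymbol x\mid\boldsymbol\mu,\tau)\,p(\boldsymbol\mu,\tau)\,d\tau$ is given by $$p(\boldsymbol x,\boldsymbol\mu)=f(\boldsymbol x-\boldsymbol\mu)^{-n}\cdot c\cdot\frac1Z\cdot p(\boldsymbol\mu),$$ where $Z$ denotes the normalization constant of the $L_p$-nested uniform distribution (as a density over $u_1,\dots,u_{n-1}$), $$Z=\int\prod_{L\in\mathcal L}G_L(\boldsymbol u_{\widehat L})\,d\boldsymbol u=2^{n-1}\prod_{I\in\mathcal I}\frac{\prod_{k=1}^{\ell_I}\Gamma\left[\frac{n_{I,k}}{p_I}\right]}{p_I^{\ell_I-1}\Gamma\left[\frac{n_I}{p_I}\right]},$$ with $\mathcal I$ the set of inner nodes (including the root) of the tree of $f$.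
   Context: **$L_p$-nested functions.** An $L_p$-nested function $f:\mathbb R^n\to[0,\infty)$ is given by a finite rooted ordered tree whose $n$ leaves, read from left to right, correspond to the coordinates $x_1,\dots,x_n$; every inner node $I$ has $\ell_I\ge 2$ children, denoted $(I,1),\dots,(I,\ell_I)$, and carries an exponent $p_I>0$; for leaves one uses the convention $p_I=1$. Nodes are denoted by multi-indices describing the path from the root; the root is $\emptyset$. For a node $I$, $\boldsymbol x_I$ denotes the coordinates at leaves in the subtree under $I$, $\boldsymbol x_{\widehat I}$ the remaining coordinates, and $n_I$ the number of leaves under $I$ ($n_I=1$ if $I$ is a leaf). Put $f_I(\boldsymbol x_I)=|x_i|$ if $I$ is the leaf of $x_i$, and $f_I(\boldsymbol x_I)=\left(\sum_{k=1}^{\ell_I} f_{I,k}(\boldsymbol x_{I,k})^{p_I}\right)^{1/p_I}$ if $I$ is an inner node; $f=f_\emptyset$. A density on $\mathbb R^n$ is $L_p$-nested symmetric with respect to $f$ if it depends on $\boldsymbol x$ only through $f(\boldsymbol x)$, i.e. has the form $\rho(f(\boldsymbol x))$. **$L_p$-nested uniform distribution.** Let $\boldsymbol u=\boldsymbol x/f(\boldsymbol x)$, with coordinates $u_1,\dots,u_{n-1}$ (up to sign, $u_n$ is determined by $f(\boldsymbol u)=1$). Let $\mathcal L$ be the set of multi-indices of the nodes on the path from the leaf of $x_n$ to the root, excluding the root. Set $g_\emptyset=1$ and, recursively down this path, $$g_{I,\ell_I}(\boldsymbol u_{\widehat{I,\ell_I}})=\Big(g_I(\boldsymbol u_{\widehat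 I})^{p_I}-\sum_{j=1}^{\ell_I-1}f_{I,j}(\boldsymbol u_{I,j})^{p_I}\Big)^{1/p_I},\qquad G_{I,\ell_I}(\boldsymbol u_{\widehat{I,\ell_I}})=g_{I,\ell_I}(\boldsymbol u_{\widehat{I,\ell_I}})^{p_{I,\ell_I}-p_I}.$$ The uniform distribution on the $L_p$-nested unit sphere $\{\boldsymbol x:f(\boldsymbol x)=1\}$ has density $\frac1Z\prod_{L\in\mathcal L}G_L(\boldsymbol u_{\widehat L})$ over $(u_1,\dots,u_{n-1})$, the integral defining $Z$ being over all $(u_1,\dots,u_{n-1})$ with $f(u_1,\dots,u_{n-1},0)<1$. The prior $p(\boldsymbol\mu)$ is an arbitrary prior density of the location, and $c$ is a constant.
   Formalization: The factor 1/Z in the joint distribution is corrected to 1/(2Z), since the density over u_1,…,u_{n-1} ignores the sign of u_n (Euclidean f, n=2, standard Gaussian: Z=π, but the integral is f^{-2}/(2π)); x≠μ is assumed so that f(x−μ)^{-n} is defined. *)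

theory Defs
  imports "HOL-Probability.Probability"
begin

text \<open>
  Points of Euclidean n-space are functions in \<open>{..<n} \<rightarrow>\<^sub>E UNIV\<close>; the coordinate written
  $x_{i+1}$ on paper is \<open>x i\<close>.
\<close>

abbreviation lborel_n :: "nat \<Rightarrow> (nat \<Rightarrow> real) measure" where
  "lborel_n n \<equiv> (\<Pi>\<^sub>M i\<in>{..<n}. lborel)"

definition prob_density :: "nat \<Rightarrow> ((nat \<Rightarrow> real) \<Rightarrow> real) \<Rightarrow> bool" where
  "prob_density n q \<longleftrightarrow> q \<in> borel_measurable (lborel_n n) \<and>
     (\<forall>x\<in>space (lborel_n n). 0 \<le> q x) \<and>
     prob_space (density (lborel_n n) (\<lambda>x. ennreal (q x)))"

text \<open>A leaf stores the index of its coordinate, an inner node its exponent and its children.\<close>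

datatype nested_tree = Leaf nat | Node real "nested_tree list"

fun leaves :: "nested_tree \<Rightarrow> nat list" where
  "leaves (Leaf i) = [i]"
| "leaves (Node p ts) = concat (map leaves ts)"

fun inner_nodes :: "nested_tree \<Rightarrow> nested_tree list" where
  "inner_nodes (Leaf i) = []"
| "inner_nodes (Node p ts) = Node p ts # concat (map inner_nodes ts)"

fun children :: "nested_tree \<Rightarrow> nested_tree list" where
  "children (Leaf i) = []"
| "children (Node p ts) = ts"

fun expo :: "nested_tree \<Rightarrow> real" where
  "expo (Leaf i) = 1"
| "expo (Node p ts) = p"

definition nested_tree_on :: "nat \<Rightarrow> nested_tree \<Rightarrow> bool" where
  "nested_tree_on n T \<longleftrightarrow> leaves T = [0..<n] \<and>
     (\<forall>I\<in>set (inner_nodes T). 2 \<le> length (children I) \<and> 0 < expo I)"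

fun nested_fun :: "nested_tree \<Rightarrow> (nat \<Rightarrow> real) \<Rightarrow> real" where
  "nested_fun (Leaf i) x = \<bar>x i\<bar>"
| "nested_fun (Node p ts) x = (\<Sum>t\<leftarrow>ts. nested_fun t x powr p) powr (1 / p)"

text \<open>
  The leaf of the last coordinate is the rightmost one, so the path leading to it always
  descends to the last child. If \<open>g\<close> is the value $g_I$ at the inner node \<open>I\<close>, then
  \<open>g_last I g u\<close> is the value at the last child of \<open>I\<close>, and \<open>G_path I g u\<close> is the product of
  the $G_L$ over all nodes \<open>L\<close> of the path strictly below \<open>I\<close>.
  Neither reads the last coordinate of \<open>u\<close>.
\<close>

definition g_last :: "nested_tree \<Rightarrow> real \<Rightarrow> (nat \<Rightarrow> real) \<Rightarrow> real" where
  "g_last I g u =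
     (g powr expo I - (\<Sum>t\<leftarrow>butlast (children I). nested_fun t u powr expo I)) powr (1 / expo I)"

function G_path :: "nested_tree \<Rightarrow> real \<Rightarrow> (nat \<Rightarrow> real) \<Rightarrow> real" where
  "G_path I g u =
     (if children I = [] then 1
      else g_last I g u powr (expo (last (children I)) - expo I) *
           G_path (last (children I)) (g_last I g u) u)"
  by pat_completeness auto
termination
proof (relation "Wellfounded.measure (\<lambda>(I, _). size I)")
  fix I :: nested_tree and g :: real and u :: "nat \<Rightarrow> real"
  assume "children I \<noteq> []"
  then obtain p ts where "I = Node p ts" "ts \<noteq> []"
    by (cases I) auto
  moreover from this have "size (last ts) \<le> size_list size ts"
    by (intro size_list_estimation'[OF last_in_set]) auto
  ultimately show "((last (children I), g_last I g u, u), I, g, u) \<in> Wellfounded.measure (\<lambda>(I, _). size I)"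
    by simp
qed simp

declare G_path.simps [simp del]

text \<open>
  The chart of the unit sphere by the first \<open>n - 1\<close> coordinates sees only one sign of the last
  coordinate, so that in polar coordinates
  $\int \varrho(f(x))\,dx = 2 Z \int_0^\infty \varrho(r) r^{n-1}\,dr$ for the constant $Z$ of
  \<open>uniform_norm_const\<close> below. For the Euclidean norm on the plane, $Z = \pi$.
\<close>

definition uniform_domain :: "nat \<Rightarrow> nested_tree \<Rightarrow> (nat \<Rightarrow> real) set" where
  "uniform_domain n T =
     {u \<in> space (lborel_n (n - 1)). nested_fun T (u(n - 1 := 0)) < 1}"

definition uniform_norm_const :: "nat \<Rightarrow> nested_tree \<Rightarrow> real" where
  "uniform_norm_const n T = (LINT u : uniform_domain n T | lborel_n (n - 1). G_path T 1 u)"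

definition location_scale ::
    "nat \<Rightarrow> nested_tree \<Rightarrow> (real \<Rightarrow> real) \<Rightarrow> (nat \<Rightarrow> real) \<Rightarrow> real \<Rightarrow> (nat \<Rightarrow> real) \<Rightarrow> real" where
  "location_scale n T \<rho> \<mu> \<tau> x = \<tau> ^ n * \<rho> (nested_fun T (\<lambda>i. \<tau> * (x i - \<mu> i)))"

end

theory Submission imports Defs begin

text \<open>
  By induction on the tree, the image of Lebesgue measure under $f_I$ has density
  $2^{n_I} C_I r^{n_I - 1}$ on the positive half-line, $C_I$ being the product of Gamma factors
  of the subtree: substituting $s_k = f_{I,k}^{p_I}$ turns the sum over the children into
  a convolution of power densities, that is, into Beta integrals.
  A second induction on the tree evaluates $\int \prod_L G_L$ over the region where $f_I < g$ as
  $2^{n_I - 1} C_I g^{n_I - p_I}$; integrating out the last child first leaves a function of the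
  sum over the other children, which the first induction reduces to one more Beta integral.
  At the root with $g = 1$ this is $Z$, and normalization of the density gives
  $\int_0^\infty \varrho(r) r^{n-1} dr = 1 / (2 Z)$. The integral over $\tau$ is this radial
  integral after the substitution $r = \tau f(x - \mu)$.
\<close>

subsection \<open>Power densities on the half-line\<close>

text \<open>For a natural number $a$ this is, up to a constant, the law of the radius under Lebesgue
  measure in dimension $a$. The parameter is real because the exponents $n_I / p_I$ occur.\<close>

definition power_measure :: "real \<Rightarrow> real measure" where
  "power_measure a = density lborel (\<lambda>s. ennreal (indicator {0<..} s * s powr (a - 1)))"

lemma sets_power_measure [measurable_cong, simp]: "sets (power_measure a) = sets borel"
  by (simp add: power_measure_def)

lemma space_power_measure [simp]: "space (power_measure a) = UNIV"
  by (simp add: power_measure_def)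

text \<open>Fubini and the measurability of inner integrals rest on this; it holds because the
  density is finite everywhere.\<close>

interpretation power_measure: sigma_finite_measure "power_measure a" for a
  unfolding power_measure_def
  by (subst sigma_finite_measure.sigma_finite_iff_density_finite[OF lborel.sigma_finite_measure_axioms]) auto

lemma nn_integral_power_measure:
  assumes [measurable]: "h \<in> borel_measurable borel"
  shows "(\<integral>\<^sup>+s. h s \<partial>power_measure a) =
    (\<integral>\<^sup>+s. ennreal (indicator {0<..} s * s powr (a - 1)) * h s \<partial>lborel)"
  unfolding power_measure_def by (rule nn_integral_density) auto

section \<open>Substitutions by powers and scalings\<close>

text \<open>The substitution is made on compact intervals inside the open half-line and extended by
  monotone convergence. Staying away from 0 covers $p < 1$, where the derivative of $r^p$ is
  unbounded near 0.\<close>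

lemma nn_integral_substitution_powr:
  fixes f :: "real \<Rightarrow> ennreal"
  assumes [measurable]: "f \<in> borel_measurable borel" and p: "0 < p"
  shows "(\<integral>\<^sup>+s. f s * indicator {0<..} s \<partial>lborel) =
    (\<integral>\<^sup>+r. f (r powr p) * ennreal (p * r powr (p - 1)) * indicator {0<..} r \<partial>lborel)"
proof -
  \<comment> \<open>The intervals exhaust the open half-line; the offset 2 gives $a_k < 1 < b_k$
    from $k = 0$ on.\<close>
  define a b :: "nat \<Rightarrow> real" where "a k = 1 / (2 + real k)" and "b k = 2 + real k" for k
  have ab: "0 < a k" "a k < b k" for k
  proof -
    show "0 < a k" by (simp add: a_def)
    have "a k < 1" by (simp add: a_def field_simps)
    also have "1 < b k" by (simp add: b_def)
    finally show "a k < b k" .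
  qed
  have step: "(\<integral>\<^sup>+s. f s * indicator {a k powr p..b k powr p} s \<partial>lborel) =
     (\<integral>\<^sup>+r. f (r powr p) * ennreal (p * r powr (p - 1)) * indicator {a k..b k} r \<partial>lborel)" for k
    using ab[of k] p
    by (intro nn_integral_substitution_aux[where g = "\<lambda>r. r powr p" and g' = "\<lambda>r. p * r powr (p - 1)"])
       (auto intro!: derivative_eq_intros continuous_intros)
  have mono: "a (Suc k) \<le> a k" "b k \<le> b (Suc k)" for k
    by (auto simp: a_def b_def frac_le)
  have powr_le: "u powr p \<le> v powr p" if "u \<le> v" "0 < u" for u v
    using that p by (intro powr_mono2) auto
  have U1: "(\<Union>k. {a k..b k}) = {0<..}"
  proof (intro equalityI subsetI)
    fix r :: real assume "r \<in> {0<..}"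
    then have r: "0 < r" by simp
    obtain k where k: "max r (1 / r) < real k" using reals_Archimedean2 by blast
    have "a k \<le> r" using k r by (auto simp: a_def field_simps)
    moreover have "r \<le> b k" using k by (auto simp: b_def)
    ultimately show "r \<in> (\<Union>k. {a k..b k})" by auto
  next
    fix r assume "r \<in> (\<Union>k. {a k..b k})"
    then show "r \<in> {0<..}" using ab(1) by (auto intro: less_le_trans)
  qed
  have U2: "(\<Union>k. {a k powr p..b k powr p}) = {0<..}"
  proof (intro equalityI subsetI)
    fix s :: real assume s: "s \<in> {0<..}"
    then have "s powr (1 / p) \<in> (\<Union>k. {a k..b k})" by (simp add: U1)
    then obtain k where k: "a k \<le> s powr (1 / p)" "s powr (1 / p) \<le> b k" by auto
    have "a k powr p \<le> (s powr (1 / p)) powr p" "(s powr (1 / p)) powr p \<le> b k powr p"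
      using k ab(1)[of k] s by (auto intro!: powr_le)
    then show "s \<in> (\<Union>k. {a k powr p..b k powr p})" using p s by (auto simp: powr_powr)
  next
    fix s assume "s \<in> (\<Union>k. {a k powr p..b k powr p})"
    then obtain k where "a k powr p \<le> s" by auto
    then show "s \<in> {0<..}" using ab(1)[of k] by (auto intro!: less_le_trans[of 0 "a k powr p" s])
  qed
  \<comment> \<open>Each side is the mass of the half-line under a measure with a density, so
    continuity from below passes from the intervals to the limit.\<close>
  let ?M = "density lborel f"
  let ?N = "density lborel (\<lambda>r. f (r powr p) * ennreal (p * r powr (p - 1)))"
  have "(\<integral>\<^sup>+s. f s * indicator {0<..} s \<partial>lborel) = emeasure ?M {0<..}"
    by (simp add: emeasure_density)
  also have "\<dots> = (SUP k. emeasure ?M {a k powr p..b k powr p})"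
    unfolding U2[symmetric] using mono powr_le ab
    by (intro SUP_emeasure_incseq[symmetric] incseq_SucI)
       (auto simp: image_subset_iff intro!: powr_le less_trans[OF ab])
  also have "\<dots> = (SUP k. emeasure ?N {a k..b k})"
    using step by (simp add: emeasure_density)
  also have "\<dots> = emeasure ?N {0<..}"
    unfolding U1[symmetric] using mono
    by (intro SUP_emeasure_incseq incseq_SucI) (auto simp: image_subset_iff)
  also have "\<dots> = (\<integral>\<^sup>+r. f (r powr p) * ennreal (p * r powr (p - 1)) * indicator {0<..} r \<partial>lborel)"
    by (simp add: emeasure_density)
  finally show ?thesis .
qed

text \<open>With $s = r^p$ the form $s^{a-1} ds$ becomes $p r^{pa-1} dr$.\<close>

lemma nn_integral_power_measure_powr:
  assumes [measurable]: "h \<in> borel_measurable borel" and p: "0 < p"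
  shows "(\<integral>\<^sup>+r. h (r powr p) \<partial>power_measure (p * a)) =
    ennreal (1 / p) * (\<integral>\<^sup>+s. h s \<partial>power_measure a)"
proof -
  have "(\<integral>\<^sup>+s. h s \<partial>power_measure a) =
      (\<integral>\<^sup>+s. (ennreal (s powr (a - 1)) * h s) * indicator {0<..} s \<partial>lborel)"
    by (subst nn_integral_power_measure) (auto intro!: nn_integral_cong simp: indicator_def)
  also have "\<dots> = (\<integral>\<^sup>+r. (ennreal ((r powr p) powr (a - 1)) * h (r powr p)) * ennreal (p * r powr (p - 1))
      * indicator {0<..} r \<partial>lborel)"
    using p by (subst nn_integral_substitution_powr) auto
  also have "\<dots> = (\<integral>\<^sup>+r. ennreal p * (ennreal (indicator {0<..} r * r powr (p * a - 1)) * h (r powr p)) \<partial>lborel)"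
  proof (rule nn_integral_cong)
    fix r :: real
    have "(r powr p) powr (a - 1) * (p * r powr (p - 1)) = p * r powr (p * a - 1)" if "0 < r"
      using that by (simp add: powr_powr powr_add[symmetric] algebra_simps)
    then have "ennreal ((r powr p) powr (a - 1)) * ennreal (p * r powr (p - 1)) =
        ennreal p * ennreal (r powr (p * a - 1))" if "0 < r"
      using that p by (simp add: ennreal_mult'[symmetric])
    then show "(ennreal ((r powr p) powr (a - 1)) * h (r powr p)) * ennreal (p * r powr (p - 1))
        * indicator {0<..} r = ennreal p * (ennreal (indicator {0<..} r * r powr (p * a - 1)) * h (r powr p))"
      by (auto simp: indicator_def) (metis mult.assoc mult.commute)
  qed
  also have "\<dots> = ennreal p * (\<integral>\<^sup>+r. h (r powr p) \<partial>power_measure (p * a))"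
    by (subst nn_integral_power_measure) (auto simp: nn_integral_cmult)
  finally show ?thesis using p
    by (simp add: mult.assoc[symmetric] ennreal_mult'[symmetric])
qed

text \<open>Homogeneity of $s^{a-1} ds$. It reduces Beta integrals to the unit interval and later
  produces the factor $f(x - \<mu>)^{-n}$.\<close>

lemma nn_integral_power_measure_scale:
  assumes [measurable]: "h \<in> borel_measurable borel" and v: "0 < v"
  shows "(\<integral>\<^sup>+s. h (v * s) \<partial>power_measure a) = ennreal (v powr - a) * (\<integral>\<^sup>+s. h s \<partial>power_measure a)"
proof -
  have "(\<integral>\<^sup>+s. h s \<partial>power_measure a) =
      ennreal v * (\<integral>\<^sup>+s. ennreal (indicator {0<..} (v * s) * (v * s) powr (a - 1)) * h (v * s) \<partial>lborel)"
    using v by (simp add: nn_integral_power_measure) (subst nn_integral_real_affine[where c = v and t = 0], auto)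
  also have "\<dots> = ennreal v * (\<integral>\<^sup>+s. ennreal (v powr (a - 1)) * (ennreal (indicator {0<..} s * s powr (a - 1)) * h (v * s)) \<partial>lborel)"
    using v by (simp add: indicator_def powr_mult ennreal_mult' zero_less_mult_iff mult.assoc of_bool_def)
      (simp add: if_distrib if_distribR cong: if_cong)
  also have "\<dots> = ennreal (v powr a) * (\<integral>\<^sup>+s. h (v * s) \<partial>power_measure a)"
    using v by (subst nn_integral_cmult)
      (auto simp: nn_integral_power_measure mult.assoc[symmetric] ennreal_mult'[symmetric] powr_diff)
  finally show ?thesis
    using v by (simp add: mult.assoc[symmetric] ennreal_mult'[symmetric] powr_minus)
qed

section \<open>Beta integrals and convolution\<close>

lemma nn_integral_Beta:
  fixes a b :: real
  assumes a: "0 < a" and b: "0 < b" and v: "0 < v"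
  shows "(\<integral>\<^sup>+s. ennreal (indicator {..<v} s * (v - s) powr (b - 1)) \<partial>power_measure a) =
    ennreal (Beta a b * v powr (a + b - 1))"
proof -
  have "(\<integral>\<^sup>+s. ennreal (indicator {..<1} s * (1 - s) powr (b - 1)) \<partial>power_measure a) =
      (\<integral>\<^sup>+s. ennreal (indicator {0..1} s * (s powr (a - 1) * (1 - s) powr (b - 1))) \<partial>lborel)"
    by (subst nn_integral_power_measure)
      (auto intro!: nn_integral_cong simp: indicator_def ennreal_mult'[symmetric])
  also have "\<dots> = ennreal (Beta a b)"
    using has_integral_Beta_real[OF a b]
    by (intro nn_integral_has_integral_lebesgue) auto
  finally have 1: "(\<integral>\<^sup>+s. ennreal (indicator {..<1} s * (1 - s) powr (b - 1)) \<partial>power_measure a) = ennreal (Beta a b)" .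
  have "(\<integral>\<^sup>+s. ennreal (indicator {..<v} s * (v - s) powr (b - 1)) \<partial>power_measure a) =
      ennreal (v powr a) * (\<integral>\<^sup>+s. ennreal (indicator {..<v} (v * s) * (v - v * s) powr (b - 1)) \<partial>power_measure a)"
    using v by (subst nn_integral_power_measure_scale[where h = "\<lambda>s. ennreal (indicator {..<v} s * (v - s) powr (b - 1))"])
      (auto simp: mult.assoc[symmetric] ennreal_mult'[symmetric] powr_minus)
  also have "(\<integral>\<^sup>+s. ennreal (indicator {..<v} (v * s) * (v - v * s) powr (b - 1)) \<partial>power_measure a) =
      (\<integral>\<^sup>+s. ennreal (v powr (b - 1)) * ennreal (indicator {..<1} s * (1 - s) powr (b - 1)) \<partial>power_measure a)"
  proof (rule nn_integral_cong)
    fix s :: real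
    have "(v - v * s) powr (b - 1) = v powr (b - 1) * (1 - s) powr (b - 1)" if "s < 1"
      using that v powr_mult[of v "1 - s" "b - 1"] by (simp add: right_diff_distrib)
    then show "ennreal (indicator {..<v} (v * s) * (v - v * s) powr (b - 1)) =
        ennreal (v powr (b - 1)) * ennreal (indicator {..<1} s * (1 - s) powr (b - 1))"
      using v by (auto simp: indicator_def ennreal_mult')
  qed
  also have "\<dots> = ennreal (v powr (b - 1)) * ennreal (Beta a b)"
    by (subst nn_integral_cmult) (auto simp: 1)
  finally show ?thesis
    by (simp add: ennreal_mult'[symmetric] mult.assoc[symmetric] powr_add[symmetric])
      (simp add: ennreal_mult'[symmetric] mult.commute algebra_simps)
qed

text \<open>After exchanging the integrals, fixing $v = s + t$ leaves a Beta integral over $s$. The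
  exponents add, just as the leaf counts of siblings do.\<close>

lemma nn_integral_power_measure_convolution:
  assumes [measurable]: "h \<in> borel_measurable borel" and a: "0 < a" and b: "0 < b"
  shows "(\<integral>\<^sup>+s. \<integral>\<^sup>+t. h (s + t) \<partial>power_measure b \<partial>power_measure a) =
    ennreal (Beta a b) * (\<integral>\<^sup>+v. h v \<partial>power_measure (a + b))"
proof -
  have shift: "(\<integral>\<^sup>+t. h (s + t) \<partial>power_measure b) =
      (\<integral>\<^sup>+v. ennreal (indicator {..<v} s * (v - s) powr (b - 1)) * h v \<partial>lborel)" for s
    by (subst nn_integral_power_measure, simp, subst nn_integral_real_affine[where c = 1 and t = "- s"])
      (auto intro!: nn_integral_cong simp: indicator_def)
  have "(\<integral>\<^sup>+s. \<integral>\<^sup>+t. h (s + t) \<partial>power_measure b \<partial>power_measure a) =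
      (\<integral>\<^sup>+s. \<integral>\<^sup>+v. ennreal (indicator {..<v} s * (v - s) powr (b - 1)) * h v \<partial>lborel \<partial>power_measure a)"
    by (simp add: shift)
  also have "\<dots> = (\<integral>\<^sup>+v. \<integral>\<^sup>+s. ennreal (indicator {..<v} s * (v - s) powr (b - 1)) * h v \<partial>power_measure a \<partial>lborel)"
  proof -
    interpret P: pair_sigma_finite "power_measure a" lborel ..
    show ?thesis
      by (rule P.Fubini'[symmetric]) (auto simp: indicator_def case_prod_unfold)
  qed
  also have "\<dots> = (\<integral>\<^sup>+v. ennreal (Beta a b) * (ennreal (indicator {0<..} v * v powr (a + b - 1)) * h v) \<partial>lborel)"
  proof (rule nn_integral_cong)
    fix v :: real
    have "(\<integral>\<^sup>+s. ennreal (indicator {..<v} s * (v - s) powr (b - 1)) \<partial>power_measure a) =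
        ennreal (Beta a b) * ennreal (indicator {0<..} v * v powr (a + b - 1))"
    proof (cases "0 < v")
      case True
      then show ?thesis by (simp add: nn_integral_Beta a b ennreal_mult''[symmetric])
    next
      \<comment> \<open>For $v \<le> 0$ no $s > 0$ lies below $v$, so the integrand
        vanishes.\<close>
      case False
      then have "(\<integral>\<^sup>+s. ennreal (indicator {..<v} s * (v - s) powr (b - 1)) \<partial>power_measure a) = 0"
        by (subst nn_integral_power_measure) (auto intro!: nn_integral_zero' simp: indicator_def)
      then show ?thesis using False by simp
    qed
    then show "(\<integral>\<^sup>+s. ennreal (indicator {..<v} s * (v - s) powr (b - 1)) * h v \<partial>power_measure a) =
        ennreal (Beta a b) * (ennreal (indicator {0<..} v * v powr (a + b - 1)) * h v)"
      by (subst nn_integral_multc) (auto simp: mult.assoc)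
  qed
  also have "\<dots> = ennreal (Beta a b) * (\<integral>\<^sup>+v. h v \<partial>power_measure (a + b))"
    by (subst nn_integral_cmult) (auto simp: nn_integral_power_measure)
  finally show ?thesis .
qed

subsection \<open>Radial integrals of nested functions\<close>

text \<open>In contrast to \<open>nested_tree_on\<close>, the leaf indices may be any distinct
  numbers, so the property passes to subtrees.\<close>

definition proper_tree :: "nested_tree \<Rightarrow> bool" where
  "proper_tree T \<longleftrightarrow> distinct (leaves T) \<and>
     (\<forall>I\<in>set (inner_nodes T). 2 \<le> length (children I) \<and> 0 < expo I)"

text \<open>For a proper tree with $n$ leaves, $2^n / n$ times this constant is the volume of the
  unit ball of $f$.\<close>

definition nested_const :: "nested_tree \<Rightarrow> real" where
  "nested_const T = (\<Prod>I\<leftarrow>inner_nodes T.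
     (\<Prod>J\<leftarrow>children I. Gamma (real (length (leaves J)) / expo I)) /
     (expo I ^ (length (children I) - 1) * Gamma (real (length (leaves I)) / expo I)))"

lemma proper_tree_Node:
  assumes "proper_tree (Node p ts)"
  shows "0 < p" "2 \<le> length ts" "distinct (concat (map leaves ts))" "\<And>t. t \<in> set ts \<Longrightarrow> proper_tree t"
proof -
  show "0 < p" "2 \<le> length ts" "distinct (concat (map leaves ts))"
    using assms by (auto simp: proper_tree_def)
  fix t assume t: "t \<in> set ts"
  have "distinct (leaves t)"
    using assms t by (auto simp: proper_tree_def distinct_concat_iff)
  then show "proper_tree t"
    using assms t by (auto simp: proper_tree_def)
qed

text \<open>Keeps every argument $n_J / p_I$ of Gamma positive, hence away from the poles.\<close>

lemma proper_tree_leaves: "proper_tree T \<Longrightarrow> leaves T \<noteq> []"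
proof (induction T)
  case (Node p ts)
  note p = proper_tree_Node[OF Node.prems]
  then obtain t ts' where "ts = t # ts'" by (cases ts) auto
  then show ?case using Node.IH[of t] p(4)[of t] by auto
qed simp

lemma nested_const_Leaf: "nested_const (Leaf i) = 1"
  by (simp add: nested_const_def)

lemma nested_const_Node:
  "nested_const (Node p ts) =
     (\<Prod>t\<leftarrow>ts. Gamma (real (length (leaves t)) / p)) /
       (p ^ (length ts - 1) * Gamma (real (length (leaves (Node p ts))) / p)) * (\<Prod>t\<leftarrow>ts. nested_const t)"
proof -
  have "(\<Prod>I\<leftarrow>concat (map inner_nodes ts). F I) = (\<Prod>t\<leftarrow>ts. \<Prod>I\<leftarrow>inner_nodes t. F I)" for F :: "nested_tree \<Rightarrow> real"
    by (induction ts) auto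
  then show ?thesis by (simp add: nested_const_def)
qed

lemma prod_list_pos:
  fixes f :: "'a \<Rightarrow> real"
  shows "(\<And>x. x \<in> set xs \<Longrightarrow> 0 < f x) \<Longrightarrow> 0 < (\<Prod>x\<leftarrow>xs. f x)"
  by (induction xs) auto

lemma nested_const_pos: "proper_tree T \<Longrightarrow> 0 < nested_const T"
proof (induction T)
  case (Node p ts)
  note p = proper_tree_Node[OF Node.prems]
  have "0 < (\<Prod>t\<leftarrow>ts. Gamma (real (length (leaves t)) / p))"
    using p proper_tree_leaves by (intro prod_list_pos Gamma_real_pos) auto
  moreover have "0 < (\<Prod>t\<leftarrow>ts. nested_const t)"
    using Node.IH p by (intro prod_list_pos) auto
  moreover have "0 < Gamma (real (length (leaves (Node p ts))) / p)"
    using proper_tree_leaves[OF Node.prems] p by (intro Gamma_real_pos) auto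
  ultimately show ?case using p by (simp add: nested_const_Node del: leaves.simps)
qed (simp add: nested_const_Leaf)

section \<open>Homogeneity, positivity and measurability of nested functions\<close>

lemma nested_fun_nonneg: "0 \<le> nested_fun T x"
  by (cases T) auto

lemma nested_fun_cong: "(\<And>i. i \<in> set (leaves T) \<Longrightarrow> x i = y i) \<Longrightarrow> nested_fun T x = nested_fun T y"
proof (induction T)
  case (Node p ts)
  have "map (\<lambda>t. nested_fun t x powr p) ts = map (\<lambda>t. nested_fun t y powr p) ts"
    using Node by (intro map_cong refl arg_cong2[where f = "(powr)"]) auto
  then show ?case by (simp only: nested_fun.simps)
qed simp

text \<open>At each inner node the power $p$ applied to the children is undone by the outer exponent
  $1/p$.\<close>

lemma nested_fun_scale:
  assumes "\<forall>I\<in>set (inner_nodes T). expo I \<noteq> 0"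
  shows "nested_fun T (\<lambda>i. c * x i) = \<bar>c\<bar> * nested_fun T x"
  using assms
proof (induction T)
  case (Node p ts)
  have p: "p \<noteq> 0" using Node.prems by simp
  have "nested_fun t (\<lambda>i. c * x i) = \<bar>c\<bar> * nested_fun t x" if "t \<in> set ts" for t
    using Node that by auto
  then have "(\<Sum>t\<leftarrow>ts. nested_fun t (\<lambda>i. c * x i) powr p) = (\<Sum>t\<leftarrow>ts. \<bar>c\<bar> powr p * nested_fun t x powr p)"
    by (intro arg_cong[where f = sum_list] map_cong refl) (auto simp: powr_mult nested_fun_nonneg)
  also have "\<dots> = \<bar>c\<bar> powr p * (\<Sum>t\<leftarrow>ts. nested_fun t x powr p)"
    by (rule sum_list_const_mult)
  finally show ?case
    using p by (simp add: powr_mult powr_powr sum_list_nonneg)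
qed (simp add: abs_mult)

lemma nested_fun_pos:
  "i \<in> set (leaves T) \<Longrightarrow> x i \<noteq> 0 \<Longrightarrow> 0 < nested_fun T x"
proof (induction T)
  case (Node p ts)
  then obtain t where t: "t \<in> set ts" "i \<in> set (leaves t)" by auto
  then have "0 < nested_fun t x powr p" using Node.IH[OF t Node.prems(2)] by simp
  also have "\<dots> \<le> (\<Sum>t\<leftarrow>ts. nested_fun t x powr p)"
    using t by (intro member_le_sum_list) auto
  finally show ?case by simp
qed simp

lemma borel_measurable_sum_list [measurable (raw)]:
  fixes f :: "'b \<Rightarrow> 'a \<Rightarrow> real"
  shows "(\<And>t. t \<in> set ts \<Longrightarrow> f t \<in> borel_measurable M) \<Longrightarrow> (\<lambda>x. \<Sum>t\<leftarrow>ts. f t x) \<in> borel_measurable M"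
  by (induction ts) auto

text \<open>The map \<open>\<phi>\<close> makes room for points obtained by resetting a coordinate,
  as in the chart of the sphere.\<close>

lemma borel_measurable_nested_fun:
  "(\<And>i. i \<in> set (leaves T) \<Longrightarrow> (\<lambda>w. \<phi> w i) \<in> borel_measurable M) \<Longrightarrow>
    (\<lambda>w. nested_fun T (\<phi> w)) \<in> borel_measurable M"
proof (induction T)
  case (Node p ts)
  then have [measurable]: "t \<in> set ts \<Longrightarrow> (\<lambda>w. nested_fun t (\<phi> w)) \<in> borel_measurable M" for t by auto
  show ?case by simp
qed auto

lemma borel_measurable_nested_fun_PiM:
  assumes "set (leaves T) \<subseteq> I"
  shows "nested_fun T \<in> borel_measurable (\<Pi>\<^sub>M i\<in>I. lborel)"
proof (rule borel_measurable_nested_fun[where \<phi> = "\<lambda>w. w"])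
  fix i assume "i \<in> set (leaves T)"
  then have [measurable]: "i \<in> I" using assms by auto
  show "(\<lambda>w. w i) \<in> borel_measurable (\<Pi>\<^sub>M i\<in>I. lborel)" by measurable
qed

section \<open>Polar coordinates by induction on the tree\<close>

lemma nn_integral_PiM_lborel_Un:
  fixes f :: "(nat \<Rightarrow> real) \<Rightarrow> ennreal"
  assumes "I \<inter> J = {}" "finite I" "finite J" "f \<in> borel_measurable (\<Pi>\<^sub>M i\<in>I \<union> J. lborel)"
  shows "(\<integral>\<^sup>+x. f x \<partial>(\<Pi>\<^sub>M i\<in>I \<union> J. lborel)) =
    (\<integral>\<^sup>+x. \<integral>\<^sup>+y. f (merge I J (x, y)) \<partial>(\<Pi>\<^sub>M i\<in>J. lborel) \<partial>(\<Pi>\<^sub>M i\<in>I. lborel))"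
proof -
  interpret product_sigma_finite "\<lambda>_::nat. lborel :: real measure" ..
  show ?thesis by (rule product_nn_integral_fold) fact+
qed

text \<open>The two half-lines contribute equally; this is the source of one factor 2 per
  leaf.\<close>

lemma nn_integral_lborel_abs:
  assumes [measurable]: "h \<in> borel_measurable borel"
  shows "(\<integral>\<^sup>+r. h \<bar>r\<bar> \<partial>lborel) = 2 * (\<integral>\<^sup>+r. h r \<partial>power_measure 1)"
proof -
  have "(\<integral>\<^sup>+r. h \<bar>r\<bar> \<partial>lborel) = (\<integral>\<^sup>+r. h r * indicator {0<..} r + h (- r) * indicator {..<0} r \<partial>lborel)"
    by (intro nn_integral_cong_AE eventually_mono[OF AE_lborel_singleton[of 0]]) (auto simp: indicator_def)
  also have "\<dots> = (\<integral>\<^sup>+r. h r * indicator {0<..} r \<partial>lborel) + (\<integral>\<^sup>+r. h (- r) * indicator {..<0} r \<partial>lborel)"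
    by (rule nn_integral_add) auto
  also have "(\<integral>\<^sup>+r. h (- r) * indicator {..<0} r \<partial>lborel) = (\<integral>\<^sup>+r. h r * indicator {0<..} r \<partial>lborel)"
    by (subst nn_integral_real_affine[where c = "-1" and t = 0])
      (auto intro!: nn_integral_cong simp: indicator_def)
  also have "(\<integral>\<^sup>+r. h r * indicator {0<..} r \<partial>lborel) = (\<integral>\<^sup>+r. h r \<partial>power_measure 1)"
    by (subst nn_integral_power_measure) (auto intro!: nn_integral_cong simp: indicator_def)
  finally show ?thesis by (simp add: mult_2)
qed

text \<open>Each $f_{I,k}^p$ has a power law with exponent $n_{I,k}/p$, and sums of such variables
  are convolutions whose Beta factors telescope to Gamma factors. The radial law of the children is
  a hypothesis so that the lemma serves both inside the induction that proves this law and
  afterwards.\<close>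

lemma nn_integral_children:
  fixes ts :: "nested_tree list" and p :: real
  assumes "ts \<noteq> []" and p: "0 < p"
    and "distinct (concat (map leaves ts))"
    and "\<And>t. t \<in> set ts \<Longrightarrow> proper_tree t"
    and radial: "\<And>t h. t \<in> set ts \<Longrightarrow> h \<in> borel_measurable borel \<Longrightarrow>
      (\<integral>\<^sup>+x. h (nested_fun t x) \<partial>(\<Pi>\<^sub>M i\<in>set (leaves t). lborel)) =
      ennreal (2 ^ length (leaves t) * nested_const t) * (\<integral>\<^sup>+r. h r \<partial>power_measure (length (leaves t)))"
    and [measurable]: "H \<in> borel_measurable borel"
  shows "(\<integral>\<^sup>+x. H (\<Sum>t\<leftarrow>ts. nested_fun t x powr p) \<partial>(\<Pi>\<^sub>M i\<in>set (concat (map leaves ts)). lborel)) =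
    ennreal (2 ^ length (concat (map leaves ts)) * (\<Prod>t\<leftarrow>ts. nested_const t) *
      (\<Prod>t\<leftarrow>ts. Gamma (length (leaves t) / p)) /
      (p ^ length ts * Gamma (length (concat (map leaves ts)) / p))) *
    (\<integral>\<^sup>+s. H s \<partial>power_measure (length (concat (map leaves ts)) / p))"
  using assms
proof (induction ts arbitrary: H rule: list_nonempty_induct)
  case (single t)
  note [measurable] = single(5)
  let ?n = "length (leaves t)"
  have n: "0 < ?n" using proper_tree_leaves[of t] single by auto
  have "(\<integral>\<^sup>+x. H (nested_fun t x powr p) \<partial>(\<Pi>\<^sub>M i\<in>set (leaves t). lborel)) =
      ennreal (2 ^ ?n * nested_const t) * (\<integral>\<^sup>+r. H (r powr p) \<partial>power_measure ?n)"
    by (rule single(4)) auto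
  also have "(\<integral>\<^sup>+r. H (r powr p) \<partial>power_measure ?n) = ennreal (1 / p) * (\<integral>\<^sup>+s. H s \<partial>power_measure (?n / p))"
    using nn_integral_power_measure_powr[of H p "?n / p"] p by simp
  finally show ?case
    using p n nested_const_pos[of t] single
    by (simp add: ennreal_mult'[symmetric] mult.assoc[symmetric] Gamma_real_pos less_imp_neq[OF Gamma_real_pos, symmetric])
next
  case (cons t ts)
  note [measurable] = cons(7)
  let ?S = "\<lambda>y. \<Sum>t\<leftarrow>ts. nested_fun t y powr p"
  let ?I = "set (leaves t)" and ?J = "set (concat (map leaves ts))"
  let ?n = "length (leaves t)" and ?m = "length (concat (map leaves ts))"
  let ?K = "2 ^ ?m * (\<Prod>t\<leftarrow>ts. nested_const t) *
      (\<Prod>t\<leftarrow>ts. Gamma (length (leaves t) / p)) / (p ^ length ts * Gamma (?m / p))"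
  have n: "0 < ?n" using proper_tree_leaves[of t] cons by auto
  have m: "0 < ?m" using proper_tree_leaves[of "hd ts"] cons(1) cons(5)[of "hd ts"] by (cases ts) auto
  \<comment> \<open>Products of reals can be merged under \<open>ennreal\<close> only for
    nonnegative factors, since negative ones are truncated to 0.\<close>
  have K: "0 \<le> ?K"
    using p m cons proper_tree_leaves nested_const_pos
    by (intro divide_nonneg_nonneg mult_nonneg_nonneg less_imp_le[OF prod_list_pos] less_imp_le[OF Gamma_real_pos]) auto
  have disj: "?I \<inter> ?J = {}" using cons by auto
  have IH: "(\<integral>\<^sup>+y. G (?S y) \<partial>(\<Pi>\<^sub>M i\<in>?J. lborel)) =
      ennreal ?K * (\<integral>\<^sup>+s. G s \<partial>power_measure (?m / p))" if "G \<in> borel_measurable borel" for G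
    using cons(3-6) that by (intro cons.IH) auto
  have meas: "set (leaves t') \<subseteq> A \<Longrightarrow> nested_fun t' \<in> borel_measurable (\<Pi>\<^sub>M i\<in>A. lborel)" for t' A
    by (rule borel_measurable_nested_fun_PiM)
  have S_meas: "(\<lambda>y. \<Sum>t\<leftarrow>t # ts. nested_fun t y powr p) \<in> borel_measurable (\<Pi>\<^sub>M i\<in>?I \<union> ?J. lborel)"
    by (intro borel_measurable_sum_list powr_real_measurable borel_measurable_const meas) auto
  have "(\<integral>\<^sup>+x. H (\<Sum>t\<leftarrow>t # ts. nested_fun t x powr p) \<partial>(\<Pi>\<^sub>M i\<in>?I \<union> ?J. lborel)) =
     (\<integral>\<^sup>+x. \<integral>\<^sup>+y. H (\<Sum>t\<leftarrow>t # ts. nested_fun t (merge ?I ?J (x, y)) powr p) \<partial>(\<Pi>\<^sub>M i\<in>?J. lborel) \<partial>(\<Pi>\<^sub>M i\<in>?I. lborel))"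
    by (intro nn_integral_PiM_lborel_Un disj measurable_compose[OF S_meas cons(7)]) auto
  also have "\<dots> = (\<integral>\<^sup>+x. \<integral>\<^sup>+y. H (nested_fun t x powr p + ?S y) \<partial>(\<Pi>\<^sub>M i\<in>?J. lborel) \<partial>(\<Pi>\<^sub>M i\<in>?I. lborel))"
  proof -
    have 1: "nested_fun t (merge ?I ?J (x, y)) = nested_fun t x" for x y
      using disj by (intro nested_fun_cong) (auto simp: merge_def)
    have 2: "?S (merge ?I ?J (x, y)) = ?S y" for x y
      using disj by (intro arg_cong[where f = sum_list] map_cong refl arg_cong2[where f = "(powr)"] nested_fun_cong)
        (auto simp: merge_def)
    show ?thesis by (simp only: sum_list.Cons list.map 1 2)
  qed
  \<comment> \<open>For fixed \<open>x\<close> the inner integral is the induction hypothesis for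
    the function \<open>H\<close> shifted by the first summand.\<close>
  also have "\<dots> = (\<integral>\<^sup>+x. ennreal ?K * (\<integral>\<^sup>+s. H (nested_fun t x powr p + s) \<partial>power_measure (?m / p)) \<partial>(\<Pi>\<^sub>M i\<in>?I. lborel))"
    by (intro nn_integral_cong IH) measurable
  also have "\<dots> = ennreal (2 ^ ?n * nested_const t) *
      (\<integral>\<^sup>+r. ennreal ?K * (\<integral>\<^sup>+s. H (r powr p + s) \<partial>power_measure (?m / p)) \<partial>power_measure ?n)"
    by (rule cons(6)) auto
  \<comment> \<open>Now $u = r^p$ turns the radial law of \<open>t\<close> into the law of the first
    summand, at the cost of $1/p$.\<close>
  also have "(\<integral>\<^sup>+r. ennreal ?K * (\<integral>\<^sup>+s. H (r powr p + s) \<partial>power_measure (?m / p)) \<partial>power_measure ?n) =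
      ennreal (1 / p) * (\<integral>\<^sup>+u. ennreal ?K * (\<integral>\<^sup>+s. H (u + s) \<partial>power_measure (?m / p)) \<partial>power_measure (?n / p))"
    using nn_integral_power_measure_powr[of "\<lambda>u. ennreal ?K * (\<integral>\<^sup>+s. H (u + s) \<partial>power_measure (?m / p))" p "?n / p"] p by simp
  also have "(\<integral>\<^sup>+u. ennreal ?K * (\<integral>\<^sup>+s. H (u + s) \<partial>power_measure (?m / p)) \<partial>power_measure (?n / p)) =
      ennreal ?K * (ennreal (Beta (?n / p) (?m / p)) * (\<integral>\<^sup>+v. H v \<partial>power_measure (?n / p + ?m / p)))"
    using n m p by (subst nn_integral_cmult) (auto simp: nn_integral_power_measure_convolution)
  also have "ennreal (2 ^ ?n * nested_const t) * (ennreal (1 / p) *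
        (ennreal ?K * (ennreal (Beta (?n / p) (?m / p)) * (\<integral>\<^sup>+v. H v \<partial>power_measure (?n / p + ?m / p))))) =
      ennreal (2 ^ ?n * nested_const t * (1 / p) * ?K * Beta (?n / p) (?m / p)) *
        (\<integral>\<^sup>+v. H v \<partial>power_measure (?n / p + ?m / p))"
  proof -
    have "0 \<le> Beta (?n / p) (?m / p)"
      unfolding Beta_def using n m p
      by (intro divide_nonneg_nonneg mult_nonneg_nonneg less_imp_le[OF Gamma_real_pos] divide_pos_pos add_pos_pos) simp_all
    moreover have "0 \<le> 2 ^ ?n * nested_const t" "0 \<le> 1 / p"
      using p nested_const_pos[of t] cons(5) by (auto simp: less_imp_le)
    moreover have "ennreal a * (ennreal b * (ennreal c * (ennreal d * X))) = ennreal (a * b * c * d) * X"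
      if "0 \<le> a" "0 \<le> b" "0 \<le> c" "0 \<le> d" for a b c d X
      using that by (simp add: ennreal_mult mult.assoc)
    ultimately show ?thesis using K by blast
  qed
  also have "?n / p + ?m / p = length (concat (map leaves (t # ts))) / p"
    by (simp add: add_divide_distrib)
  \<comment> \<open>The telescoping: $Gamma(m/p)$ in the denominator of \<open>?K\<close> cancels
    against the numerator of the Beta factor.\<close>
  also have "2 ^ ?n * nested_const t * (1 / p) * ?K * Beta (?n / p) (?m / p) =
     2 ^ length (concat (map leaves (t # ts))) * (\<Prod>t\<leftarrow>t # ts. nested_const t) *
      (\<Prod>t\<leftarrow>t # ts. Gamma (length (leaves t) / p)) /
      (p ^ length (t # ts) * Gamma (length (concat (map leaves (t # ts))) / p))"
  proof -
    have "Gamma (?m / p) \<noteq> 0" using m p by (intro less_imp_neq[OF Gamma_real_pos, symmetric]) auto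
    then show ?thesis
      using p by (simp add: Beta_def power_add add_divide_distrib[symmetric] divide_simps)
  qed
  finally show ?case by simp
qed

text \<open>At an inner node the law of the sum over the children is known, and $r = s^{1/p}$
  converts it into the law of $f_I$.\<close>

lemma nn_integral_nested_fun:
  assumes "proper_tree T" "h \<in> borel_measurable borel"
  shows "(\<integral>\<^sup>+x. h (nested_fun T x) \<partial>(\<Pi>\<^sub>M i\<in>set (leaves T). lborel)) =
      ennreal (2 ^ length (leaves T) * nested_const T) * (\<integral>\<^sup>+r. h r \<partial>power_measure (length (leaves T)))"
  using assms
proof (induction T arbitrary: h)
  case (Leaf i)
  note [measurable] = Leaf(2)
  interpret product_sigma_finite "\<lambda>_::nat. lborel :: real measure" ..
  have "(\<integral>\<^sup>+x. h \<bar>x i\<bar> \<partial>(\<Pi>\<^sub>M i\<in>{i}. lborel)) = (\<integral>\<^sup>+r. h \<bar>r\<bar> \<partial>lborel)"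
    by (rule product_nn_integral_singleton) auto
  then show ?case by (simp add: nn_integral_lborel_abs nested_const_Leaf)
next
  case (Node p ts)
  note [measurable] = Node.prems(2)
  note p = proper_tree_Node[OF Node.prems(1)]
  let ?n = "length (leaves (Node p ts))"
  let ?G = "\<Prod>t\<leftarrow>ts. Gamma (length (leaves t) / p)"
  have ts: "ts \<noteq> []" using p(2) by auto
  have "(\<integral>\<^sup>+x. h (nested_fun (Node p ts) x) \<partial>(\<Pi>\<^sub>M i\<in>set (leaves (Node p ts)). lborel)) =
    ennreal (2 ^ ?n * (\<Prod>t\<leftarrow>ts. nested_const t) * ?G / (p ^ length ts * Gamma (?n / p))) *
      (\<integral>\<^sup>+s. h (s powr (1 / p)) \<partial>power_measure (?n / p))"
    using nn_integral_children[of ts p "\<lambda>s. h (s powr (1 / p))"] ts p Node.IH by simp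
  also have "(\<integral>\<^sup>+s. h (s powr (1 / p)) \<partial>power_measure (?n / p)) = ennreal p * (\<integral>\<^sup>+r. h r \<partial>power_measure ?n)"
    using nn_integral_power_measure_powr[of h "1 / p" ?n] p by simp
  also have "ennreal (2 ^ ?n * (\<Prod>t\<leftarrow>ts. nested_const t) * ?G / (p ^ length ts * Gamma (?n / p))) *
      (ennreal p * (\<integral>\<^sup>+r. h r \<partial>power_measure ?n)) =
      ennreal (2 ^ ?n * (\<Prod>t\<leftarrow>ts. nested_const t) * ?G / (p ^ length ts * Gamma (?n / p)) * p) *
       (\<integral>\<^sup>+r. h r \<partial>power_measure ?n)"
    using p by (simp only: mult.assoc[symmetric] ennreal_mult''[OF less_imp_le])
  \<comment> \<open>The outer root contributes a factor $p$, which lowers the power of $p$ from the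
    number of children to one less.\<close>
  also have "2 ^ ?n * (\<Prod>t\<leftarrow>ts. nested_const t) * ?G / (p ^ length ts * Gamma (?n / p)) * p =
      2 ^ ?n * nested_const (Node p ts)"
  proof -
    have "p ^ length ts = p * p ^ (length ts - 1)" using ts by (cases ts) auto
    then show ?thesis using p by (simp add: nested_const_Node del: leaves.simps)
  qed
  finally show ?case .
qed

subsection \<open>The normalization constant\<close>

lemma butlast_leaves_Node:
  "leaves l \<noteq> [] \<Longrightarrow> butlast (leaves (Node p (bs @ [l]))) = concat (map leaves bs) @ butlast (leaves l)"
  by (simp add: butlast_append)

lemma G_path_Leaf: "G_path (Leaf i) g u = 1"
  by (simp add: G_path.simps)

lemma G_path_Node:
  "G_path (Node p (bs @ [l])) g u =
    ((g powr p - (\<Sum>t\<leftarrow>bs. nested_fun t u powr p)) powr (1 / p)) powr (expo l - p) *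
    G_path l ((g powr p - (\<Sum>t\<leftarrow>bs. nested_fun t u powr p)) powr (1 / p)) u"
  by (subst G_path.simps) (simp add: g_last_def)

lemma G_path_nonneg: "0 \<le> G_path T g u"
proof (induction T g u rule: G_path.induct)
  case (1 I g u)
  then show ?case by (subst G_path.simps) auto
qed

lemma proper_tree_Node_snoc:
  assumes "proper_tree (Node p ts)"
  obtains bs l where "ts = bs @ [l]" "bs \<noteq> []" "proper_tree l" "leaves l \<noteq> []" "0 < p"
proof -
  note p = proper_tree_Node[OF assms]
  have "ts = butlast ts @ [last ts]" "butlast ts \<noteq> []" "last ts \<in> set ts"
    using p(2) by (cases ts rule: rev_cases; auto)+
  then show ?thesis using that[of "butlast ts" "last ts"] p proper_tree_leaves by auto
qed

text \<open>At every level only the children to the left of the path are evaluated, so the product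
  is a function on the chart.\<close>

lemma G_path_cong:
  "proper_tree T \<Longrightarrow> (\<And>i. i \<in> set (butlast (leaves T)) \<Longrightarrow> u i = v i) \<Longrightarrow> G_path T g u = G_path T g v"
proof (induction T arbitrary: g)
  case (Node p ts)
  obtain bs l where ts: "ts = bs @ [l]" "proper_tree l" "leaves l \<noteq> []"
    by (rule proper_tree_Node_snoc[OF Node.prems(1)])
  have uv: "u i = v i" if "i \<in> set (concat (map leaves bs) @ butlast (leaves l))" for i
    using Node.prems(2)[of i] that butlast_leaves_Node[OF ts(3), of p bs] ts(1) by metis
  have "(\<Sum>t\<leftarrow>bs. nested_fun t u powr p) = (\<Sum>t\<leftarrow>bs. nested_fun t v powr p)"
    by (intro arg_cong[where f = sum_list] map_cong refl arg_cong2[where f = "(powr)"] nested_fun_cong)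
      (auto intro!: uv)
  moreover have "G_path l g u = G_path l g v" for g
    by (rule Node.IH) (auto intro!: uv simp: ts)
  ultimately show ?case by (simp add: ts(1) G_path_Node)
qed (simp add: G_path_Leaf)

text \<open>The value \<open>\<gamma>\<close> varies with the point because the recursion replaces
  the constant $g$ by $g_L(u)$.\<close>

lemma borel_measurable_G_path:
  assumes "proper_tree T" "\<And>i. i \<in> set (butlast (leaves T)) \<Longrightarrow> (\<lambda>w. \<phi> w i) \<in> borel_measurable M"
    and "\<gamma> \<in> borel_measurable M"
  shows "(\<lambda>w. G_path T (\<gamma> w) (\<phi> w)) \<in> borel_measurable M"
  using assms
proof (induction T arbitrary: \<gamma>)
  case (Node p ts)
  note [measurable] = Node.prems(3)
  obtain bs l where ts: "ts = bs @ [l]" "proper_tree l" "leaves l \<noteq> []"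
    by (rule proper_tree_Node_snoc[OF Node.prems(1)])
  have \<phi>: "(\<lambda>w. \<phi> w i) \<in> borel_measurable M" if "i \<in> set (concat (map leaves bs) @ butlast (leaves l))" for i
    using Node.prems(2)[of i] that butlast_leaves_Node[OF ts(3), of p bs] ts(1) by metis
  have [measurable]: "(\<lambda>w. \<Sum>t\<leftarrow>bs. nested_fun t (\<phi> w) powr p) \<in> borel_measurable M"
    by (intro borel_measurable_sum_list powr_real_measurable borel_measurable_const borel_measurable_nested_fun \<phi>) auto
  have [measurable]: "(\<lambda>w. G_path l ((\<gamma> w powr p - (\<Sum>t\<leftarrow>bs. nested_fun t (\<phi> w) powr p)) powr (1 / p)) (\<phi> w))
      \<in> borel_measurable M"
    by (rule Node.IH) (auto intro!: \<phi> simp: ts)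
  show ?case unfolding ts(1) G_path_Node by measurable
qed (simp add: G_path_Leaf)

lemma borel_measurable_nested_fun_chart:
  assumes "set (butlast (leaves T)) \<subseteq> A"
  shows "(\<lambda>u. nested_fun T (u(last (leaves T) := 0))) \<in> borel_measurable (\<Pi>\<^sub>M i\<in>A. lborel)"
proof (rule borel_measurable_nested_fun)
  fix i assume "i \<in> set (leaves T)"
  then have "i = last (leaves T) \<or> i \<in> A"
    using assms by (cases "leaves T" rule: rev_cases) auto
  then show "(\<lambda>u. (u(last (leaves T) := 0)) i) \<in> borel_measurable (\<Pi>\<^sub>M i\<in>A. lborel)"
    by (cases "i = last (leaves T)") auto
qed

lemma borel_measurable_G_path_PiM:
  assumes "proper_tree T" "set (butlast (leaves T)) \<subseteq> A"
  shows "G_path T g \<in> borel_measurable (\<Pi>\<^sub>M i\<in>A. lborel)"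
  using assms by (intro borel_measurable_G_path[where \<phi> = "\<lambda>u. u" and \<gamma> = "\<lambda>_. g"]) auto

section \<open>The integral over the chart\<close>

lemma powr_inverse_less_iff:
  fixes a g q :: real
  assumes "0 \<le> a" "0 < g" "0 < q"
  shows "a powr (1 / q) < g \<longleftrightarrow> a < g powr q"
proof
  assume "a powr (1 / q) < g"
  then have "(a powr (1 / q)) powr q < g powr q" using assms by (intro powr_less_mono2) auto
  then show "a < g powr q" using assms by (simp add: powr_powr)
next
  assume "a < g powr q"
  then have "a powr (1 / q) < (g powr q) powr (1 / q)" using assms by (intro powr_less_mono2) auto
  then show "a powr (1 / q) < g" using assms by (simp add: powr_powr)
qed

text \<open>A general radius $g$ is required for the induction: with $d = g^p - S$, $S$ being the
  sum over the other children, the last child is met with radius $d^{1/p}$.\<close>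

lemma nn_integral_G_path:
  assumes "proper_tree T" "0 < g"
  shows "(\<integral>\<^sup>+u. indicator {u. nested_fun T (u(last (leaves T) := 0)) < g} u * ennreal (G_path T g u)
      \<partial>(\<Pi>\<^sub>M i\<in>set (butlast (leaves T)). lborel)) =
    ennreal (2 ^ (length (leaves T) - 1) * nested_const T * g powr (length (leaves T) - expo T))"
  using assms
proof (induction T arbitrary: g)
  case (Leaf i)
  \<comment> \<open>A leaf has no chart coordinate, so the integral is a value at a single point;
    the convention $p_I = 1$ makes the exponent of $g$ zero.\<close>
  show ?case using Leaf by (simp add: PiM_empty nn_integral_count_space_finite G_path_Leaf nested_const_Leaf)
next
  case (Node p ts)
  note p = proper_tree_Node[OF Node.prems(1)]
  obtain bs l where ts: "ts = bs @ [l]" "bs \<noteq> []" and l: "proper_tree l" "leaves l \<noteq> []"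
    by (rule proper_tree_Node_snoc[OF Node.prems(1)])
  let ?I = "set (concat (map leaves bs))" and ?J = "set (butlast (leaves l))" and ?j = "last (leaves l)"
  let ?m = "length (concat (map leaves bs))" and ?k = "length (leaves l)" and ?n = "length (leaves (Node p ts))"
  let ?S = "\<lambda>x. \<Sum>t\<leftarrow>bs. nested_fun t x powr p"
  let ?d = "\<lambda>x. g powr p - ?S x"
  let ?P = "\<lambda>I. \<Pi>\<^sub>M i\<in>I. (lborel :: real measure)"
  define F where "F u = indicator {u. nested_fun (Node p ts) (u(last (leaves (Node p ts)) := 0)) < g} u *
    ennreal (G_path (Node p ts) g u)" for u
  have g: "0 < g" by fact
  have n: "?n = ?m + ?k" "0 < ?k" using ts l by auto
  have m: "0 < ?m"
    using proper_tree_leaves[OF p(4)[of "hd bs"]] ts by (cases bs) auto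
  have leaves: "last (leaves (Node p ts)) = ?j" "set (butlast (leaves (Node p ts))) = ?I \<union> ?J"
    using butlast_leaves_Node[OF l(2), of p bs] ts(1) l(2) by (auto simp del: concat_map_singleton)
  have dist: "distinct (concat (map leaves bs) @ butlast (leaves l) @ [?j])"
    using p(3) ts l(2) by simp
  have S_nonneg: "0 \<le> ?S x" for x by (rule sum_list_nonneg) auto
  \<comment> \<open>Here \<open>x\<close> holds the other children and \<open>y\<close> the chart
    coordinates of the last one. The region splits into a condition on the sum at \<open>x\<close>
    and the region of the last child with radius \<open>?d x powr (1 / p)\<close>.\<close>
  have F_merge: "F (merge ?I ?J (x, y)) = indicator {..<g powr p} (?S x) *
      (ennreal ((?d x powr (1 / p)) powr (expo l - p)) *
       (indicator {u. nested_fun l (u(?j := 0)) < ?d x powr (1 / p)} y * ennreal (G_path l (?d x powr (1 / p)) y)))"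
    for x y
  proof -
    let ?u = "merge ?I ?J (x, y)"
    \<comment> \<open>The coordinate \<open>?j\<close> belongs to the last child, so resetting it
      does not affect the sum.\<close>
    have S: "?S (?u(?j := 0)) = ?S x" "?S ?u = ?S x"
      using dist
      by (auto intro!: arg_cong[where f = sum_list] arg_cong2[where f = "(powr)"] nested_fun_cong simp: merge_def)
    have f: "nested_fun l (?u(?j := 0)) = nested_fun l (y(?j := 0))"
    proof (rule nested_fun_cong)
      fix i assume "i \<in> set (leaves l)"
      then have "i = ?j \<or> i \<in> ?J"
        by (metis append_butlast_last_id l(2) in_set_conv_decomp_last insert_iff list.simps(15) rotate1.simps(2) set_rotate1)
      then show "(?u(?j := 0)) i = (y(?j := 0)) i" using dist by (auto simp: merge_def)
    qed
    have G: "G_path l c ?u = G_path l c y" for c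
      using dist by (intro G_path_cong l) (auto simp: merge_def)
    have "nested_fun (Node p ts) (?u(?j := 0)) < g \<longleftrightarrow> ?S x + nested_fun l (y(?j := 0)) powr p < g powr p"
      using S f S_nonneg[of x] g p(1) by (simp add: ts(1) powr_inverse_less_iff del: fun_upd_apply)
    also have "\<dots> \<longleftrightarrow> ?S x < g powr p \<and> nested_fun l (y(?j := 0)) < ?d x powr (1 / p)"
    proof (cases "?S x < g powr p")
      case True
      then show ?thesis
        \<comment> \<open>Taken with exponent $1/p$, so that its root is the power $p$.\<close>
        using powr_inverse_less_iff[of "nested_fun l (y(?j := 0))" "?d x" "1 / p"] p(1)
        by (auto simp: nested_fun_nonneg)
    next
      case False
      then show ?thesis by (smt (verit) powr_ge_zero)
    qed
    finally have iff: "nested_fun (Node p ts) (?u(?j := 0)) < g \<longleftrightarrow>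
        ?S x < g powr p \<and> nested_fun l (y(?j := 0)) < ?d x powr (1 / p)" .
    have "F ?u = (if nested_fun (Node p ts) (?u(?j := 0)) < g then ennreal (G_path (Node p ts) g ?u) else 0)"
      unfolding F_def leaves(1) by (simp add: indicator_def)
    also have "G_path (Node p ts) g ?u = (?d x powr (1 / p)) powr (expo l - p) * G_path l (?d x powr (1 / p)) y"
      by (simp only: ts(1) G_path_Node S G)
    finally show ?thesis unfolding iff by (auto simp: indicator_def ennreal_mult')
  qed
  have "F \<in> borel_measurable (?P (?I \<union> ?J))"
  proof -
    have [measurable]: "(\<lambda>u. nested_fun (Node p ts) (u(?j := 0))) \<in> borel_measurable (?P (?I \<union> ?J))"
      using borel_measurable_nested_fun_chart[of "Node p ts"] unfolding leaves by blast
    have [measurable]: "G_path (Node p ts) g \<in> borel_measurable (?P (?I \<union> ?J))"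
      using borel_measurable_G_path_PiM[OF Node.prems(1)] unfolding leaves by blast
    show ?thesis unfolding F_def leaves by measurable
  qed
  then have "(\<integral>\<^sup>+u. F u \<partial>?P (?I \<union> ?J)) = (\<integral>\<^sup>+x. \<integral>\<^sup>+y. F (merge ?I ?J (x, y)) \<partial>?P ?J \<partial>?P ?I)"
    using dist by (intro nn_integral_PiM_lborel_Un) auto
  also have "\<dots> = (\<integral>\<^sup>+x. ennreal (2 ^ (?k - 1) * nested_const l) *
      ennreal (indicator {..<g powr p} (?S x) * ?d x powr (?k / p - 1)) \<partial>?P ?I)"
  proof (rule nn_integral_cong)
    fix x
    let ?c = "?d x powr (1 / p)"
    show "(\<integral>\<^sup>+y. F (merge ?I ?J (x, y)) \<partial>?P ?J) = ennreal (2 ^ (?k - 1) * nested_const l) *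
        ennreal (indicator {..<g powr p} (?S x) * ?d x powr (?k / p - 1))"
    proof (cases "?S x < g powr p")
      case True
      then have c: "0 < ?c" by auto
      have meas: "(\<lambda>y. indicator {u. nested_fun l (u(?j := 0)) < ?c} y * ennreal (G_path l ?c y)) \<in> borel_measurable (?P ?J)"
      proof -
        have [measurable]: "(\<lambda>u. nested_fun l (u(?j := 0))) \<in> borel_measurable (?P ?J)"
          by (rule borel_measurable_nested_fun_chart) simp
        have [measurable]: "G_path l ?c \<in> borel_measurable (?P ?J)"
          by (rule borel_measurable_G_path_PiM[OF l(1)]) simp
        show ?thesis by measurable
      qed
      have "(\<integral>\<^sup>+y. F (merge ?I ?J (x, y)) \<partial>?P ?J) = ennreal (?c powr (expo l - p)) *
          (\<integral>\<^sup>+y. indicator {u. nested_fun l (u(?j := 0)) < ?c} y * ennreal (G_path l ?c y) \<partial>?P ?J)"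
        using True unfolding F_merge nn_integral_cmult[OF meas, symmetric] by simp
      also have "\<dots> = ennreal (?c powr (expo l - p)) * ennreal (2 ^ (?k - 1) * nested_const l * ?c powr (?k - expo l))"
        using c l(1) ts(1) by (subst Node.IH) auto
      also have "\<dots> = ennreal (2 ^ (?k - 1) * nested_const l * (?c powr (expo l - p) * ?c powr (?k - expo l)))"
        by (simp add: ennreal_mult'[symmetric] ac_simps)
      \<comment> \<open>The exponent of the last child cancels between its own factor $G_L$ and the
        induction hypothesis.\<close>
      also have "?c powr (expo l - p) * ?c powr (?k - expo l) = ?d x powr (?k / p - 1)"
      proof -
        have "1 / p * (expo l - p) + 1 / p * (?k - expo l) = ?k / p - 1"
          using p(1) by (simp add: right_diff_distrib diff_divide_distrib)
        then show ?thesis by (simp only: powr_powr powr_add[symmetric])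
      qed
      finally show ?thesis
        using True nested_const_pos[OF l(1)] by (simp add: ennreal_mult')
    next
      case False
      then show ?thesis unfolding F_merge by simp
    qed
  qed
  \<comment> \<open>What remains depends on \<open>x\<close> only through the sum, so it reduces to
    a one-dimensional integral, which is again of Beta type.\<close>
  also have "\<dots> = ennreal (2 ^ ?m * (\<Prod>t\<leftarrow>bs. nested_const t) *
      (\<Prod>t\<leftarrow>bs. Gamma (length (leaves t) / p)) / (p ^ length bs * Gamma (?m / p))) *
    (\<integral>\<^sup>+s. ennreal (2 ^ (?k - 1) * nested_const l) *
      ennreal (indicator {..<g powr p} s * (g powr p - s) powr (?k / p - 1)) \<partial>power_measure (?m / p))"
    using dist ts p by (intro nn_integral_children nn_integral_nested_fun) auto
  also have "(\<integral>\<^sup>+s. ennreal (2 ^ (?k - 1) * nested_const l) *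
      ennreal (indicator {..<g powr p} s * (g powr p - s) powr (?k / p - 1)) \<partial>power_measure (?m / p)) =
      ennreal (2 ^ (?k - 1) * nested_const l) * ennreal (Beta (?m / p) (?k / p) * (g powr p) powr (?m / p + ?k / p - 1))"
    using m n g p(1) by (subst nn_integral_cmult) (auto simp: nn_integral_Beta)
  also have "ennreal (2 ^ ?m * (\<Prod>t\<leftarrow>bs. nested_const t) *
      (\<Prod>t\<leftarrow>bs. Gamma (length (leaves t) / p)) / (p ^ length bs * Gamma (?m / p))) *
      (ennreal (2 ^ (?k - 1) * nested_const l) * ennreal (Beta (?m / p) (?k / p) * (g powr p) powr (?m / p + ?k / p - 1))) =
      ennreal (2 ^ ?m * (\<Prod>t\<leftarrow>bs. nested_const t) *
        (\<Prod>t\<leftarrow>bs. Gamma (length (leaves t) / p)) / (p ^ length bs * Gamma (?m / p)) *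
      (2 ^ (?k - 1) * nested_const l * (Beta (?m / p) (?k / p) * (g powr p) powr (?m / p + ?k / p - 1))))"
  proof -
    have "0 \<le> 2 ^ (?k - 1) * nested_const l" using nested_const_pos[OF l(1)] by simp
    moreover have "0 \<le> Beta (?m / p) (?k / p) * (g powr p) powr (?m / p + ?k / p - 1)"
      unfolding Beta_def using m n p(1)
      by (intro divide_nonneg_nonneg mult_nonneg_nonneg less_imp_le[OF Gamma_real_pos] divide_pos_pos add_pos_pos) simp_all
    ultimately show ?thesis by (simp only: ennreal_mult'' mult_nonneg_nonneg)
  qed
  \<comment> \<open>The Beta factor replaces $Gamma(m/p)$ by $Gamma(k/p)$, the missing factor of the
    last child. Only the children in \<open>bs\<close> carry a $1/p$, which matches the exponent of
    $p$ in the constant.\<close>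
  also have "2 ^ ?m * (\<Prod>t\<leftarrow>bs. nested_const t) *
        (\<Prod>t\<leftarrow>bs. Gamma (length (leaves t) / p)) / (p ^ length bs * Gamma (?m / p)) *
      (2 ^ (?k - 1) * nested_const l * (Beta (?m / p) (?k / p) * (g powr p) powr (?m / p + ?k / p - 1))) =
      2 ^ (?n - 1) * nested_const (Node p ts) * g powr (?n - expo (Node p ts))"
  proof -
    have "(g powr p) powr (?m / p + ?k / p - 1) = g powr (?n - p)"
    proof -
      have "p * (?m / p + ?k / p - 1) = ?n - p"
        using p(1) n(1) by (simp add: right_diff_distrib distrib_left)
      then show ?thesis by (simp only: powr_powr)
    qed
    moreover have "2 ^ ?m * 2 ^ (?k - 1) = (2 ^ (?n - 1) :: real)"
    proof -
      have "?m + (?k - 1) = ?n - 1" using n by linarith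
      then show ?thesis by (simp only: power_add[symmetric])
    qed
    moreover have "Beta (?m / p) (?k / p) = Gamma (?m / p) * Gamma (?k / p) / Gamma (?n / p)"
      using n by (simp add: Beta_def add_divide_distrib)
    moreover have "Gamma (?m / p) \<noteq> 0"
      using m p(1) by (intro less_imp_neq[OF Gamma_real_pos, symmetric]) auto
    moreover have "nested_const (Node p ts) = (\<Prod>t\<leftarrow>bs. Gamma (length (leaves t) / p)) * Gamma (?k / p) /
        (p ^ length bs * Gamma (?n / p)) * ((\<Prod>t\<leftarrow>bs. nested_const t) * nested_const l)"
      by (simp add: nested_const_Node ts(1) del: leaves.simps)
    ultimately show ?thesis
      by (simp add: mult.assoc[symmetric] del: leaves.simps)
  qed
  finally show ?case unfolding F_def leaves .
qed

section \<open>The joint density\<close>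

text \<open>The chart integral $Z$ accounts for one sign of the last coordinate, so the whole sphere
  contributes $2 Z$; hence $1 / (2 Z)$. Integrability accompanies each value because a Bochner
  integral is 0 by default where it fails.\<close>

theorem proposition6:
  fixes n :: nat and T :: nested_tree and \<rho> :: "real \<Rightarrow> real"
    and prior :: "(nat \<Rightarrow> real) \<Rightarrow> real" and c :: real and x \<mu> :: "nat \<Rightarrow> real"
  assumes tree: "nested_tree_on n T"
    and rho: "prob_density n (\<lambda>y. \<rho> (nested_fun T y))"
    and prior: "prior \<in> borel_measurable (lborel_n n)"
      "\<And>y. y \<in> space (lborel_n n) \<Longrightarrow> 0 \<le> prior y"
    and points: "x \<in> space (lborel_n n)" "\<mu> \<in> space (lborel_n n)" "x \<noteq> \<mu>"
  shows "set_integrable lborel {0<..} (\<lambda>\<tau>. location_scale n T \<rho> \<mu> \<tau> x * (prior \<mu> * (c * inverse \<tau>))) \<and>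
         (LBINT \<tau>:{0<..}. location_scale n T \<rho> \<mu> \<tau> x * (prior \<mu> * (c * inverse \<tau>))) =
           nested_fun T (\<lambda>i. x i - \<mu> i) powr (- real n) * c *
             (1 / (2 * uniform_norm_const n T)) * prior \<mu> \<and>
         set_integrable (lborel_n (n - 1)) (uniform_domain n T) (G_path T 1) \<and>
         uniform_norm_const n T =
           2 ^ (n - 1) *
           (\<Prod>I\<leftarrow>inner_nodes T.
              (\<Prod>J\<leftarrow>children I. Gamma (real (length (leaves J)) / expo I)) /
              (expo I ^ (length (children I) - 1) * Gamma (real (length (leaves I)) / expo I)))"
proof -
  have leaves: "leaves T = [0..<n]" and proper: "proper_tree T"
    using tree by (auto simp: nested_tree_on_def proper_tree_def)
  have n: "0 < n" using proper_tree_leaves[OF proper] leaves by auto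
  have chart: "set (butlast (leaves T)) = {..<n - 1}" "last (leaves T) = n - 1"
    using n by (cases n; auto simp: leaves)+
  define C where "C = nested_const T"
  have C: "0 < C" unfolding C_def by (rule nested_const_pos) fact
  define Z where "Z = 2 ^ (n - 1) * C"
  \<comment> \<open>Relates the polar constant $2^n C$ to the chart constant $2^{n-1} C$: the factor
    2 is the sign of the last coordinate.\<close>
  have Z: "0 < Z" "2 ^ n * C = 2 * Z"
    using C n by (cases n; simp add: Z_def)+

  have f_meas: "(\<lambda>u. nested_fun T (u(n - 1 := 0))) \<in> borel_measurable (lborel_n (n - 1))"
    using borel_measurable_nested_fun_chart[of T] unfolding chart by blast
  have G_meas: "G_path T 1 \<in> borel_measurable (lborel_n (n - 1))"
    using borel_measurable_G_path_PiM[OF proper] unfolding chart by blast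
  let ?W = "\<lambda>u. indicator (uniform_domain n T) u *\<^sub>R G_path T 1 u"
  have dom: "uniform_domain n T \<in> sets (lborel_n (n - 1))"
    using f_meas unfolding uniform_domain_def by measurable
  have "(\<integral>\<^sup>+u. ennreal (?W u) \<partial>lborel_n (n - 1)) =
      (\<integral>\<^sup>+u. indicator {u. nested_fun T (u(n - 1 := 0)) < 1} u * ennreal (G_path T 1 u) \<partial>lborel_n (n - 1))"
    by (intro nn_integral_cong) (auto simp: uniform_domain_def indicator_def)
  also have "\<dots> = ennreal Z"
    using nn_integral_G_path[OF proper, of 1] unfolding chart by (simp add: leaves Z_def C_def)
  finally have "integrable (lborel_n (n - 1)) ?W \<and> integral\<^sup>L (lborel_n (n - 1)) ?W = Z"
    using Z G_meas dom G_path_nonneg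
    by (subst (asm) nn_integral_eq_integrable) auto
  then have norm_const: "set_integrable (lborel_n (n - 1)) (uniform_domain n T) (G_path T 1)"
      "uniform_norm_const n T = Z"
    by (auto simp: set_integrable_def uniform_norm_const_def set_lebesgue_integral_def)

  define R where "R = nested_fun T (\<lambda>i. x i - \<mu> i)"
  have scale: "nested_fun T (\<lambda>i. a * y i) = \<bar>a\<bar> * nested_fun T y" for a y
    using proper by (intro nested_fun_scale) (auto simp: proper_tree_def)
  have R: "0 < R"
  proof -
    obtain i where "i < n" "x i \<noteq> \<mu> i"
      using points by (auto simp: space_PiM) (metis PiE_ext lessThan_iff)
    then show ?thesis unfolding R_def by (intro nested_fun_pos) (auto simp: leaves)
  qed
  \<comment> \<open>A line in the direction of $x - \<mu>$, normalized so that $f$ equals $|r|$ at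
    parameter $r$. Composing the density with it transfers measurability and nonnegativity to
    \<open>\<rho>\<close> itself.\<close>
  let ?ray = "\<lambda>r. \<lambda>i\<in>{..<n}. r / R * (x i - \<mu> i)"
  have ray: "nested_fun T (?ray r) = \<bar>r\<bar>" for r
  proof -
    have "nested_fun T (?ray r) = nested_fun T (\<lambda>i. r / R * (x i - \<mu> i))"
      by (rule nested_fun_cong) (auto simp: leaves)
    also have "\<dots> = \<bar>r\<bar>" unfolding scale R_def[symmetric] using R by simp
    finally show ?thesis .
  qed
  \<comment> \<open>The absolute value confines \<open>\<rho>\<close> to the values of $f$; on
    negative arguments \<open>\<rho>\<close> is arbitrary.\<close>
  have rho_meas [measurable]: "(\<lambda>r. \<rho> \<bar>r\<bar>) \<in> borel_measurable borel"
  proof -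
    have "?ray \<in> borel \<rightarrow>\<^sub>M lborel_n n" by measurable
    moreover have "(\<lambda>y. \<rho> (nested_fun T y)) \<in> borel_measurable (lborel_n n)"
      using rho by (simp add: prob_density_def)
    ultimately have "(\<lambda>r. \<rho> (nested_fun T (?ray r))) \<in> borel_measurable borel"
      by (rule measurable_compose)
    then show ?thesis unfolding ray .
  qed
  have rho_nonneg: "0 \<le> \<rho> \<bar>r\<bar>" for r
  proof -
    have "?ray r \<in> space (lborel_n n)" by (simp add: space_PiM)
    then have "0 \<le> \<rho> (nested_fun T (?ray r))" using rho unfolding prob_density_def by blast
    then show ?thesis unfolding ray .
  qed
  have "(\<integral>\<^sup>+y. ennreal (\<rho> (nested_fun T y)) \<partial>lborel_n n) = 1"
  proof -
    let ?D = "density (lborel_n n) (\<lambda>y. ennreal (\<rho> (nested_fun T y)))"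
    have "emeasure ?D (space ?D) = 1"
      using rho unfolding prob_density_def by (intro prob_space.emeasure_space_1) auto
    then show ?thesis using rho unfolding prob_density_def by (subst (asm) emeasure_density) (auto simp: indicator_def cong: nn_integral_cong_simp)
  qed
  \<comment> \<open>Polar coordinates turn total mass 1 into the value of the radial
    integral.\<close>
  moreover have "(\<integral>\<^sup>+y. ennreal (\<rho> (nested_fun T y)) \<partial>lborel_n n) =
      ennreal (2 * Z) * (\<integral>\<^sup>+r. ennreal (\<rho> \<bar>r\<bar>) \<partial>power_measure n)"
  proof -
    have "{..<n} = set (leaves T)" by (auto simp: leaves)
    then show ?thesis
      using nn_integral_nested_fun[OF proper, of "\<lambda>r. ennreal (\<rho> \<bar>r\<bar>)"] Z(2)
      by (simp add: nested_fun_nonneg leaves C_def)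
  qed
  ultimately have "ennreal (1 / (2 * Z)) * (ennreal (2 * Z) * (\<integral>\<^sup>+r. ennreal (\<rho> \<bar>r\<bar>) \<partial>power_measure n)) = ennreal (1 / (2 * Z))"
    by simp
  then have radial: "(\<integral>\<^sup>+r. ennreal (\<rho> \<bar>r\<bar>) \<partial>power_measure n) = ennreal (1 / (2 * Z))"
    using Z by (simp add: mult.assoc[symmetric] ennreal_mult'[symmetric])

  \<comment> \<open>The factor \<open>\<tau> ^ n\<close> and the Jeffreys prior combine to the
    density of \<open>power_measure n\<close>, so scaling by \<open>R\<close> applies.\<close>
  let ?L = "\<lambda>\<tau>. indicator {0<..} \<tau> * (\<tau> powr (real n - 1) * \<rho> \<bar>R * \<tau>\<bar>)"
  have "(\<integral>\<^sup>+\<tau>. ennreal (?L \<tau>) \<partial>lborel) = (\<integral>\<^sup>+\<tau>. ennreal (\<rho> \<bar>R * \<tau>\<bar>) \<partial>power_measure n)"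
    by (subst nn_integral_power_measure) (auto intro!: nn_integral_cong simp: ennreal_mult' rho_nonneg indicator_def)
  also have "\<dots> = ennreal (R powr - real n * (1 / (2 * Z)))"
    using nn_integral_power_measure_scale[of "\<lambda>r. ennreal (\<rho> \<bar>r\<bar>)" R "real n"] R Z
    by (simp only: radial ennreal_mult'[OF powr_ge_zero]) simp
  finally have "integrable lborel ?L \<and> integral\<^sup>L lborel ?L = R powr - real n * (1 / (2 * Z))"
    using Z rho_nonneg by (subst (asm) nn_integral_eq_integrable) auto
  then have L: "has_bochner_integral lborel ?L (R powr - real n * (1 / (2 * Z)))"
    by (simp add: has_bochner_integral_iff)
  \<comment> \<open>The constant \<open>c\<close> may have either sign, so it enters only now, by
    linearity of the Bochner integral.\<close>
  have "has_bochner_integral lborel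
      (\<lambda>\<tau>. indicator {0<..} \<tau> *\<^sub>R (location_scale n T \<rho> \<mu> \<tau> x * (prior \<mu> * (c * inverse \<tau>))))
      (R powr - real n * (1 / (2 * Z)) * (prior \<mu> * c))"
  proof (rule has_bochner_integral_cong[THEN iffD1, OF refl _ refl has_bochner_integral_mult_left[OF L]])
    fix \<tau> :: real
    have "location_scale n T \<rho> \<mu> \<tau> x * inverse \<tau> = \<tau> powr (real n - 1) * \<rho> \<bar>R * \<tau>\<bar>" if "0 < \<tau>"
      using that R unfolding location_scale_def scale R_def[symmetric]
      by (simp add: powr_diff powr_realpow divide_inverse ac_simps)
    then show "?L \<tau> * (prior \<mu> * c) =
        indicator {0<..} \<tau> *\<^sub>R (location_scale n T \<rho> \<mu> \<tau> x * (prior \<mu> * (c * inverse \<tau>)))"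
      by (auto simp: indicator_def ac_simps)
  qed
  then have joint:
    "set_integrable lborel {0<..} (\<lambda>\<tau>. location_scale n T \<rho> \<mu> \<tau> x * (prior \<mu> * (c * inverse \<tau>)))"
    "(LBINT \<tau>:{0<..}. location_scale n T \<rho> \<mu> \<tau> x * (prior \<mu> * (c * inverse \<tau>))) =
      R powr - real n * (1 / (2 * Z)) * (prior \<mu> * c)"
    by (simp_all only: has_bochner_integral_iff set_integrable_def set_lebesgue_integral_def)
  show ?thesis
    by (intro conjI joint(1) norm_const(1), unfold joint(2) norm_const(2) R_def[symmetric])
      (simp_all only: Z_def C_def nested_const_def ac_simps)
qed

end
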